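(* Let $p$ be an odd prime, let $k>0$ be an integer, and let $G = C_{2p^k}(S)$ be a circulant graph on $n = 2p^k$ vertices with $\emptyset\neq S\subseteq\{1,\ldots,p^k\}$ (i.e. $G$ has at least one edge). Then $\widetilde{\chi}(\Delta(G)) \neq 0$.
   Context: For $S \subseteq \{1,\ldots,\lfloor n/2\rfloor\}$, the circulant graph $C_n(S)$ is the simple graph with vertex set $\mathbb{Z}_n=\{0,\ldots,n-1\}$ and edge set $\{\{i,j\} : |j-i|_n \in S\}$, where $|k|_n=\min\{|k|, n-|k|\}$. The independence complex $\Delta(G)$ is the simplicial complex whose faces are the independent sets of $G$. If $f_{i-1}$ denotes the number of independent sets of cardinality $i$ (so $f_{-1}=1$) and $d$ is the maximum cardinality of an independent set, the reduced Euler characteristic is $\widetilde{\chi}(\Delta(G))=\sum_{i=0}^{d}(-1)^{i-1}f_{i-1}$. *)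

theory Defs
  imports "HOL-Computational_Algebra.Primes"
begin

text \<open>A graph is a pair of a vertex set and a set of edges, each edge being a set of vertices.\<close>

type_synonym 'a graph = "'a set \<times> 'a set set"

abbreviation verts :: "'a graph \<Rightarrow> 'a set" where "verts \<equiv> fst"

abbreviation edges :: "'a graph \<Rightarrow> 'a set set" where "edges \<equiv> snd"

definition simple_graph :: "'a graph \<Rightarrow> bool" where
  "simple_graph G \<longleftrightarrow> finite (verts G) \<and> (\<forall>e\<in>edges G. e \<subseteq> verts G \<and> card e = 2)"

definition circ_abs :: "nat \<Rightarrow> int \<Rightarrow> int" where
  "circ_abs n k = min \<bar>k\<bar> (int n - \<bar>k\<bar>)"

text \<open>The connection set \<open>S\<close> is meant to be a subset of \<open>{1..n div 2}\<close>; this is what excludes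
  loops (see below), and it is a hypothesis wherever the graph is used.\<close>

definition circulant_graph :: "nat \<Rightarrow> int set \<Rightarrow> int graph" where
  "circulant_graph n S =
     ({0..<int n},
      {{i, j} |i j. i \<in> {0..<int n} \<and> j \<in> {0..<int n} \<and> circ_abs n (j - i) \<in> S})"

lemma simple_graph_circulant_graph:
  assumes "S \<subseteq> {1..int (n div 2)}"
  shows "simple_graph (circulant_graph n S)"
proof -
  have "i \<noteq> j" if "circ_abs n (j - i) \<in> S" for i j
    using that assms by (auto simp: circ_abs_def)
  then show ?thesis
    by (auto simp: simple_graph_def circulant_graph_def card_2_iff) blast+
qed

definition indep_set :: "'a graph \<Rightarrow> 'a set \<Rightarrow> bool" where
  "indep_set G W \<longleftrightarrow> W \<subseteq> verts G \<and> (\<forall>u\<in>W. \<forall>v\<in>W. {u, v} \<notin> edges G)"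

definition independence_complex :: "'a graph \<Rightarrow> 'a set set" where
  "independence_complex G = {W. indep_set G W}"

text \<open>A simplicial complex is given by its set of faces, the empty face included.
  The number \<open>face_count K i\<close> is the entry $f_{i-1}$ of the f-vector: the index is the cardinality
  of the faces, not their dimension.\<close>

definition face_count :: "'a set set \<Rightarrow> nat \<Rightarrow> nat" where
  "face_count K i = card {F \<in> K. card F = i}"

text \<open>The sign $(-1)^{i-1}$ is written \<open>(-1) ^ (i + 1)\<close>, since natural-number subtraction would
  give the wrong sign at \<open>i = 0\<close>. The upper bound is the maximal cardinality of a face.\<close>

definition reduced_euler_char :: "'a set set \<Rightarrow> int" where
  "reduced_euler_char K = (\<Sum>i = 0..Max (card ` K). (-1) ^ (i + 1) * int (face_count K i))"

end

theory Submission
  imports Defs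
begin

text \<open>The rotation by \<open>2\<close> generates a group of order \<open>p ^ k\<close> acting on the faces of the
  complex, so modulo \<open>p\<close> only the invariant faces contribute to the Euler characteristic. An
  invariant face is empty, the set \<open>E\<close> of even vertices, the set \<open>O\<close> of odd vertices, or
  everything. The last one is excluded by the existence of an edge, and \<open>E\<close>, \<open>O\<close> are both faces
  (if \<open>S\<close> has only odd elements) or both not. As they have odd cardinality, the Euler
  characteristic is congruent to \<open>- 1\<close> or \<open>- 1 + 1 + 1 = 1\<close> modulo \<open>p\<close>.\<close>

section \<open>Orbits of a periodic map and sums modulo a prime\<close>

lemma card_funpow_orbit_dvd:
  assumes "(f ^^ n) x = x" and "n > 0"
  shows "card (range (\<lambda>i. (f ^^ i) x)) dvd n"
proof -
  \<comment> \<open>The least positive return time. The orbit is the first \<open>m\<close>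
    iterates, and \<open>n mod m\<close>, again a return time, must be 0.\<close>
  define m where "m = (LEAST m. m > 0 \<and> (f ^^ m) x = x)"
  have m: "m > 0" "(f ^^ m) x = x"
    using LeastI[of "\<lambda>m. m > 0 \<and> (f ^^ m) x = x" n] assms by (auto simp: m_def)
  have least: "m \<le> j" if "j > 0" "(f ^^ j) x = x" for j
    unfolding m_def using that by (intro Least_le) auto
  have "range (\<lambda>i. (f ^^ i) x) = (\<lambda>i. (f ^^ i) x) ` {..<m}"
  proof -
    have "(f ^^ i) x \<in> (\<lambda>i. (f ^^ i) x) ` {..<m}" for i
      using funpow_mod_eq[OF m(2), of i] m(1) by (intro image_eqI[of _ _ "i mod m"]) auto
    then show ?thesis by auto
  qed
  moreover have "inj_on (\<lambda>i. (f ^^ i) x) {..<m}"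
  proof (rule linorder_inj_onI)
    fix i j assume ij: "i < j" "i \<in> {..<m}" "j \<in> {..<m}"
    show "(f ^^ i) x \<noteq> (f ^^ j) x"
    proof
      assume "(f ^^ i) x = (f ^^ j) x"
      \<comment> \<open>Applying \<open>m - j\<close> further steps turns a coincidence into a
        return time \<open>m - j + i\<close>, which is positive and below \<open>m\<close>.\<close>
      then have "(f ^^ (m - j + i)) x = (f ^^ (m - j + j)) x"
        by (simp only: funpow_add o_def)
      also have "\<dots> = x" using ij m by simp
      finally show False using least[of "m - j + i"] ij by simp
    qed
  qed auto
  ultimately have "card (range (\<lambda>i. (f ^^ i) x)) = m"
    by (simp add: card_image)
  moreover have "n mod m = 0"
  proof (rule ccontr)
    assume "n mod m \<noteq> 0"
    then have "m \<le> n mod m"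
      using least[of "n mod m"] funpow_mod_eq[OF m(2), of n] assms(1) by simp
    then show False using m(1) by (meson mod_less_divisor not_less)
  qed
  ultimately show ?thesis by auto
qed

text \<open>Induction removing one orbit at a time: \<open>g\<close> is constant on an orbit, and
  the orbit size divides \<open>p ^ k\<close> but is not 1, hence is a multiple of
  \<open>p\<close>.\<close>

lemma prime_dvd_sum_fixed_point_free:
  fixes p k :: nat and g :: "'a \<Rightarrow> int"
  assumes "prime p" and "finite F"
    and "\<And>x. x \<in> F \<Longrightarrow> f x \<in> F" and "\<And>x. x \<in> F \<Longrightarrow> (f ^^ (p ^ k)) x = x"
    and "\<And>x. x \<in> F \<Longrightarrow> f x \<noteq> x" and "\<And>x. x \<in> F \<Longrightarrow> g (f x) = g x"
  shows "int p dvd sum g F"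
  using assms(2-)
proof (induction F rule: finite_psubset_induct)
  case (psubset F)
  show ?case
  proof (cases "F = {}")
    case False
    then obtain y where y: "y \<in> F" by auto
    define B where "B = range (\<lambda>i. (f ^^ i) y)"
    have pk: "p ^ k > 0" using \<open>prime p\<close> by (simp add: prime_gt_0_nat)
    have iter: "(f ^^ i) y \<in> F \<and> g ((f ^^ i) y) = g y" for i
      by (induction i) (use y psubset.prems in auto)
    have BF: "B \<subseteq> F" and yB: "y \<in> B" and fB: "f y \<in> B"
      using iter by (auto simp: B_def intro: range_eqI[of _ _ 0] range_eqI[of _ _ 1])
    have finB: "finite B" using BF psubset.hyps finite_subset by auto
    \<comment> \<open>The induction hypothesis needs \<open>F - B\<close> closed under
      \<open>f\<close>. This holds because \<open>f ^^ (p ^ k - 1)\<close> inverts \<open>f\<close>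
      on \<open>F\<close> and stays in the orbit.\<close>
    have preimage_B: "x \<in> B" if "x \<in> F" "f x \<in> B" for x
    proof -
      from that obtain i where "f x = (f ^^ i) y" by (auto simp: B_def)
      then have "(f ^^ (p ^ k - 1)) (f x) = (f ^^ (p ^ k - 1 + i)) y"
        by (simp add: funpow_add)
      moreover have "(f ^^ (p ^ k - 1)) (f x) = (f ^^ Suc (p ^ k - 1)) x"
        by (simp add: funpow_swap1)
      then have "(f ^^ (p ^ k - 1)) (f x) = x"
        using psubset.prems(2)[OF that(1)] pk by (simp del: funpow.simps)
      ultimately show ?thesis unfolding B_def by (metis rangeI)
    qed
    have "card B dvd p ^ k"
      unfolding B_def using card_funpow_orbit_dvd psubset.prems(2)[OF y] pk by metis
    then obtain j where j: "card B = p ^ j"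
      using \<open>prime p\<close> by (auto simp: divides_primepow_nat)
    have "card {y, f y} \<le> card B"
      using finB yB fB by (intro card_mono) auto
    then have "card B \<noteq> 1" using psubset.prems(3)[OF y] by auto
    then have "p dvd card B" using j by (cases j) auto
    moreover have "sum g B = int (card B) * g y"
      using sum.cong[of B B g "\<lambda>_. g y"] iter unfolding B_def by fastforce
    ultimately have "int p dvd sum g B" by simp
    moreover have "int p dvd sum g (F - B)"
      using psubset.prems preimage_B y yB by (intro psubset.IH) auto
    moreover have "sum g F = sum g (F - B) + sum g B"
      using BF psubset.hyps by (simp add: sum.subset_diff)
    ultimately show ?thesis by simp
  qed auto
qed

lemma prime_dvd_sum_diff_fixed_points:
  fixes p k :: nat and g :: "'a \<Rightarrow> int"
  assumes "prime p" and "finite F"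
    and "\<And>x. x \<in> F \<Longrightarrow> f x \<in> F" and per: "\<And>x. x \<in> F \<Longrightarrow> (f ^^ (p ^ k)) x = x"
    and "\<And>x. x \<in> F \<Longrightarrow> g (f x) = g x"
  shows "int p dvd sum g F - sum g {x \<in> F. f x = x}"
proof -
  have "sum g F = sum g (F - {x \<in> F. f x = x}) + sum g {x \<in> F. f x = x}"
    using assms(2) by (intro sum.subset_diff) auto
  moreover have "int p dvd sum g (F - {x \<in> F. f x = x})"
  proof (rule prime_dvd_sum_fixed_point_free[OF assms(1), where f = f and k = k])
    show "f x \<in> F - {x \<in> F. f x = x}" if x: "x \<in> F - {x \<in> F. f x = x}" for x
    proof -
      \<comment> \<open>A non-fixed point cannot move to a fixed one: if \<open>f x\<close> is
        fixed, then \<open>x = (f ^^ (p ^ k)) x = (f ^^ (p ^ k - 1)) (f x) = f x\<close>.\<close>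
      have "f x = x" if "f (f x) = f x"
      proof -
        have "(f ^^ i) (f x) = f x" for i by (induction i) (use that in auto)
        moreover have "(f ^^ (p ^ k - 1)) (f x) = (f ^^ Suc (p ^ k - 1)) x"
          by (simp add: funpow_swap1)
        ultimately show ?thesis
          using per[of x] x \<open>prime p\<close> by (simp add: prime_gt_0_nat del: funpow.simps)
      qed
      then show ?thesis using x assms(3) by auto
    qed
  qed (use assms in auto)
  ultimately show ?thesis by simp
qed

section \<open>Reformulating the Euler characteristic and the circular distance\<close>

lemma reduced_euler_char_eq_sum_faces:
  assumes "finite K"
  shows "reduced_euler_char K = (\<Sum>F\<in>K. (-1) ^ (card F + 1))"
proof -
  have "(\<Sum>F\<in>K. (-1) ^ (card F + 1) :: int) =
      (\<Sum>i = 0..Max (card ` K). \<Sum>F | F \<in> K \<and> card F = i. (-1) ^ (card F + 1))"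
    by (intro sum.group[symmetric]) (use assms in auto)
  also have "\<dots> = reduced_euler_char K"
    unfolding reduced_euler_char_def face_count_def by (intro sum.cong) auto
  finally show ?thesis by simp
qed

text \<open>For differences of vertices the distance depends only on the residue modulo
  \<open>n\<close>, so invariance under rotation reduces to a congruence.\<close>

lemma circ_abs_mod:
  assumes "\<bar>d\<bar> < int n"
  shows "circ_abs n d = min (d mod int n) (int n - d mod int n)"
proof (cases "d \<ge> 0")
  case False
  then have "d mod int n = d + int n"
    using assms mod_pos_pos_trivial[of "d + int n" "int n"] by simp
  then show ?thesis using False by (auto simp: circ_abs_def)
qed (use assms in \<open>auto simp: circ_abs_def\<close>)

lemma indep_set_circulant_graph_iff:
  "indep_set (circulant_graph n S) W \<longleftrightarrow>
    W \<subseteq> {0..<int n} \<and> (\<forall>u\<in>W. \<forall>v\<in>W. circ_abs n (v - u) \<notin> S)"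
proof -
  have "circ_abs n (u - v) = circ_abs n (v - u)" for u v
    by (simp add: circ_abs_def abs_minus_commute)
  then show ?thesis
    by (auto simp: indep_set_def circulant_graph_def doubleton_eq_iff subset_iff; metis)
qed

section \<open>Rotations and parity classes\<close>

definition rotate_set :: "int \<Rightarrow> int \<Rightarrow> int set \<Rightarrow> int set" where
  "rotate_set n a W = (\<lambda>x. (x + a) mod n) ` W"

lemma funpow_rotate_set:
  assumes "W \<subseteq> {0..<n}"
  shows "(rotate_set n a ^^ i) W = rotate_set n (int i * a) W"
proof (induction i)
  case 0
  have "(\<lambda>x. x mod n) ` W = id ` W" using assms by (intro image_cong) auto
  then show ?case by (simp add: rotate_set_def)
next
  case (Suc i)
  then show ?case
    by (simp add: rotate_set_def image_image mod_simps algebra_simps)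
qed

lemma inj_on_add_mod: "inj_on (\<lambda>x. (x + a) mod n) {0..<n}" for n a :: int
proof (rule inj_onI)
  fix x y assume "x \<in> {0..<n}" "y \<in> {0..<n}" "(x + a) mod n = (y + a) mod n"
  then have "(x + a - a) mod n = (y + a - a) mod n" by (metis mod_diff_left_eq)
  then show "x = y" using \<open>x \<in> {0..<n}\<close> \<open>y \<in> {0..<n}\<close> by simp
qed

lemma indep_set_rotate_set:
  assumes "indep_set (circulant_graph n S) W" and "n > 0"
  shows "indep_set (circulant_graph n S) (rotate_set (int n) a W)"
proof -
  have "circ_abs n ((v + a) mod int n - (u + a) mod int n) = circ_abs n (v - u)"
    if "u \<in> {0..<int n}" "v \<in> {0..<int n}" for u v
  proof -
    have "\<bar>(v + a) mod int n - (u + a) mod int n\<bar> < int n"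
      using pos_mod_bound[of "int n" "v + a"] pos_mod_bound[of "int n" "u + a"]
        pos_mod_sign[of "int n" "v + a"] pos_mod_sign[of "int n" "u + a"] assms(2) by linarith
    moreover have "\<bar>v - u\<bar> < int n" using that by auto
    moreover have "((v + a) mod int n - (u + a) mod int n) mod int n = (v - u) mod int n"
      by (simp add: mod_diff_eq)
    ultimately show ?thesis by (simp add: circ_abs_mod)
  qed
  then show ?thesis
    using assms by (auto simp: indep_set_circulant_graph_iff rotate_set_def subset_iff)
qed

text \<open>Provides every vertex \<open>x\<close> with a neighbour for each \<open>s\<close> in the
  connection set; \<open>s\<close> is the smaller of \<open>s\<close> and \<open>n - s\<close> as it
  is at most half of \<open>n\<close>.\<close>

lemma circ_abs_add_mod:
  assumes "x \<in> {0..<int n}" and "s \<in> {1..int (n div 2)}"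
  shows "circ_abs n ((x + s) mod int n - x) = s"
proof -
  have n: "n > 0" "s < int n" "s \<le> int n - s" using assms by auto
  have "\<bar>(x + s) mod int n - x\<bar> < int n"
    using pos_mod_bound[of "int n" "x + s"] pos_mod_sign[of "int n" "x + s"] assms(1) n
    unfolding atLeastLessThan_iff by linarith
  moreover have "((x + s) mod int n - x) mod int n = s"
    using assms n by (simp add: mod_diff_left_eq)
  ultimately show ?thesis using n by (simp add: circ_abs_mod)
qed

lemma even_circ_abs_iff: "even n \<Longrightarrow> even (circ_abs n d) \<longleftrightarrow> even d"
  by (simp add: circ_abs_def min_def)

lemma even_add_mod_diff_iff: "even n \<Longrightarrow> even ((x + s) mod n - x) \<longleftrightarrow> even s" for n x s :: int
  by (auto simp: dvd_mod_iff)

text \<open>Repeated rotation by 2 carries \<open>x\<close> to every vertex of the same parity, so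
  an invariant set is a union of parity classes.\<close>

lemma rotate_set_2_fixed_memD:
  assumes "rotate_set n 2 W = W" and "W \<subseteq> {0..<n}" and "x \<in> W"
    and "y \<in> {0..<n}" and "even (y - x)" and "even n"
  shows "y \<in> W"
proof -
  \<comment> \<open>The summand \<open>n\<close> keeps the number of rotations nonnegative when
    \<open>y < x\<close>; it vanishes modulo \<open>n\<close>.\<close>
  define i where "i = nat ((y - x + n) div 2)"
  have x: "x \<in> {0..<n}" using assms by auto
  have i: "int i * 2 = y - x + n"
    using x assms(4-6) by (auto simp: i_def)
  have "(rotate_set n 2 ^^ i) W = W"
    by (induction i) (use assms in auto)
  then have "(x + int i * 2) mod n \<in> W"
    using funpow_rotate_set[OF assms(2), of i 2] assms(3) by (auto simp: rotate_set_def)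
  then show ?thesis using i assms(4) by simp
qed

lemma card_parity_class:
  assumes "r \<in> {0, 1}"
  shows "card {x \<in> {0..<2 * int m}. x mod 2 = r} = m"
proof -
  have "{x \<in> {0..<2 * int m}. x mod 2 = r} = (\<lambda>i. 2 * int i + r) ` {..<m}"
  proof (intro equalityI subsetI)
    fix x assume "x \<in> {x \<in> {0..<2 * int m}. x mod 2 = r}"
    then show "x \<in> (\<lambda>i. 2 * int i + r) ` {..<m}"
      by (intro image_eqI[of _ _ "nat (x div 2)"]) auto
  qed (use assms in auto)
  then show ?thesis by (simp add: card_image inj_on_def)
qed

section \<open>The Euler characteristic modulo \<open>p\<close>\<close>

theorem theorem2p9:
  fixes p k :: nat and S :: "int set"
  assumes "prime p" and "odd p" and "k > 0"
    and "S \<noteq> {}" and "S \<subseteq> {1..int (p ^ k)}"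
  shows "reduced_euler_char (independence_complex (circulant_graph (2 * p ^ k) S)) \<noteq> 0"
proof -
  define n where "n = 2 * p ^ k"
  define K where "K = {W. indep_set (circulant_graph n S) W}"
  define f where "f = rotate_set (int n) 2"
  define g where "g W = ((-1) ^ (card W + 1) :: int)" for W :: "int set"
  \<comment> \<open>\<open>C 0\<close> and \<open>C 1\<close> are the sets of even and of odd
    vertices; for other \<open>r\<close> the set is empty.\<close>
  define C where "C r = {x \<in> {0..<int n}. x mod 2 = r}" for r :: int
  have n: "n > 0" "even n" and S: "S \<subseteq> {1..int (n div 2)}"
    using assms by (auto simp: n_def prime_gt_0_nat)
  have KV: "W \<subseteq> {0..<int n}" if "W \<in> K" for W
    using that by (simp add: K_def indep_set_circulant_graph_iff)
  have K_no_edge: "circ_abs n (v - u) \<notin> S" if "W \<in> K" "u \<in> W" "v \<in> W" for W u v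
    using that by (simp add: K_def indep_set_circulant_graph_iff)
  have finK: "finite K"
    using KV by (intro finite_subset[of K "Pow {0..<int n}"]) auto
  have "int p dvd sum g K - sum g {W \<in> K. f W = W}"
  proof (rule prime_dvd_sum_diff_fixed_points[where k = k])
    fix W assume W: "W \<in> K"
    show "f W \<in> K" using W n by (simp add: K_def f_def indep_set_rotate_set)
    \<comment> \<open>In total \<open>p ^ k\<close> rotations by 2 shift by
      \<open>n = 2 * p ^ k\<close>, which is the identity.\<close>
    have "(f ^^ (p ^ k)) W = rotate_set (int n) (int n) W"
      using funpow_rotate_set[OF KV[OF W], of "p ^ k" 2] by (simp add: f_def n_def mult.commute)
    also have "\<dots> = rotate_set (int n) 0 W" by (simp add: rotate_set_def)
    also have "\<dots> = W" using funpow_rotate_set[OF KV[OF W], of 0 0] by simp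
    finally show "(f ^^ (p ^ k)) W = W" .
    have "card (f W) = card W"
      unfolding f_def rotate_set_def
      using KV[OF W] inj_on_add_mod by (intro card_image) (rule inj_on_subset)
    then show "g (f W) = g W" by (simp add: g_def)
  qed (use assms finK in auto)
  moreover have "sum g {W \<in> K. f W = W} \<in> {1, -1}"
  proof (cases "\<exists>s\<in>S. even s")
    case True
    then obtain s where s: "s \<in> S" "even s" by auto
    have "W = {}" if W: "W \<in> K" "f W = W" for W
    proof (rule ccontr)
      assume "W \<noteq> {}"
      then obtain x where x: "x \<in> W" by auto
      \<comment> \<open>As \<open>s\<close> is even, this neighbour of \<open>x\<close> has the
        parity of \<open>x\<close>, so invariance puts an edge inside \<open>W\<close>.\<close>
      have "(x + s) mod int n \<in> W"
      proof (rule rotate_set_2_fixed_memD[OF W(2)[unfolded f_def] KV[OF W(1)] x])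
        show "even ((x + s) mod int n - x)" using even_add_mod_diff_iff n(2) s(2) by simp
      qed (use n in auto)
      moreover have "circ_abs n ((x + s) mod int n - x) = s"
        using KV[OF W(1)] x s(1) S by (intro circ_abs_add_mod) auto
      ultimately show False
        using K_no_edge[OF W(1) x, of "(x + s) mod int n"] s(1) by simp
    qed
    moreover have "{} \<in> K" "f {} = {}"
      by (auto simp: K_def indep_set_circulant_graph_iff f_def rotate_set_def)
    ultimately have "{W \<in> K. f W = W} = {{}}" by auto
    then show ?thesis by (simp add: g_def)
  next
    case False
    from assms(4) obtain s where s: "s \<in> S" by auto
    have "odd s" using False s by auto
    have finC: "finite (C r)" for r
      by (rule finite_subset[of _ "{0..<int n}"]) (auto simp: C_def)
    have C: "C r \<in> K \<and> f (C r) = C r" for r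
    proof
      have "circ_abs n (v - u) \<notin> S" if "u \<in> C r" "v \<in> C r" for u v
      proof -
        have "even (v - u)" using that by (auto simp: C_def mod_eq_dvd_iff)
        then show ?thesis using False n(2) even_circ_abs_iff by blast
      qed
      then show "C r \<in> K" by (auto simp: K_def indep_set_circulant_graph_iff C_def)
      \<comment> \<open>Reduction modulo the even \<open>n\<close> keeps parity; injectivity of the
        rotation then upgrades the inclusion to equality.\<close>
      have "f (C r) \<subseteq> C r"
        using n by (auto simp: f_def rotate_set_def C_def mod_mod_cancel)
      moreover have "card (f (C r)) = card (C r)"
        unfolding f_def rotate_set_def
        by (intro card_image inj_on_subset[OF inj_on_add_mod]) (auto simp: C_def)
      ultimately show "f (C r) = C r"
        using finC by (intro card_subset_eq) auto
    qed
    have fixed: "W = C (x mod 2)" if W: "W \<in> K" "f W = W" and x: "x \<in> W" for W x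
    proof (intro equalityI subsetI)
      fix y assume "y \<in> C (x mod 2)"
      then show "y \<in> W"
        using rotate_set_2_fixed_memD[of "int n" W x y] W KV[OF W(1)] x n
        by (auto simp: f_def C_def mod_eq_dvd_iff)
    next
      fix y assume y: "y \<in> W"
      have "even (y - x)"
      proof (rule ccontr)
        assume odd: "odd (y - x)"
        \<comment> \<open>With both parities in \<open>W\<close>, the neighbour \<open>x + s\<close>
          of \<open>x\<close> has the parity of \<open>y\<close>, as \<open>s\<close> is odd, and so
          lies in \<open>W\<close> as well.\<close>
        have "(x + s) mod int n \<in> W"
        proof (rule rotate_set_2_fixed_memD[OF W(2)[unfolded f_def] KV[OF W(1)] y])
          have "odd ((x + s) mod int n - x)"
            using even_add_mod_diff_iff n(2) \<open>odd s\<close> by simp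
          then show "even ((x + s) mod int n - y)" using odd by auto
        qed (use n in auto)
        moreover have "circ_abs n ((x + s) mod int n - x) = s"
          using KV[OF W(1)] x s S by (intro circ_abs_add_mod) auto
        ultimately show False
          using K_no_edge[OF W(1) x, of "(x + s) mod int n"] s by simp
      qed
      then show "y \<in> C (x mod 2)"
        using y KV[OF W(1)] by (auto simp: C_def mod_eq_dvd_iff)
    qed
    have "W \<in> {{}, C 0, C 1}" if W: "W \<in> K" "f W = W" for W
    proof (cases "W = {}")
      case False
      then obtain x where "x \<in> W" by auto
      then have "W = C (x mod 2)" using fixed W by blast
      moreover have "x mod 2 = 0 \<or> x mod 2 = 1" by (simp add: mod2_eq_if)
      ultimately show ?thesis by (metis insertI1 insertI2)
    qed auto
    moreover have "{} \<in> K" "f {} = {}"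
      by (auto simp: K_def indep_set_circulant_graph_iff f_def rotate_set_def)
    ultimately have eq: "{W \<in> K. f W = W} = {{}, C 0, C 1}" using C by auto
    have card: "card (C 0) = p ^ k" "card (C 1) = p ^ k"
      using card_parity_class[of 0 "p ^ k"] card_parity_class[of 1 "p ^ k"]
      by (auto simp: C_def n_def)
    \<comment> \<open>The three invariant faces must be distinct for the sum to have three
      terms.\<close>
    have "0 \<in> C 0" "1 \<in> C 1" "0 \<notin> C 1"
      using n by (auto simp: C_def elim: evenE)
    then have "{} \<noteq> C 0" "{} \<noteq> C 1" "C 0 \<noteq> C 1" by auto
    then show ?thesis using eq card \<open>odd p\<close> by (simp add: g_def)
  qed
  moreover have "reduced_euler_char (independence_complex (circulant_graph n S)) = sum g K"
    using reduced_euler_char_eq_sum_faces[OF finK] by (simp add: K_def g_def independence_complex_def)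
  \<comment> \<open>If the Euler characteristic were 0, then \<open>p\<close> would divide 1 or
    -1.\<close>
  moreover have "\<not> int p dvd 1" using \<open>prime p\<close> by auto
  ultimately show ?thesis unfolding n_def by auto
qed

end
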